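(* Let $\mathcal V^\omega$ be an oplax monoidal category. The extended and the abridged definitions of a category enriched over $\mathcal V$ are canonically equivalent. Explicitly: for every category $\mathcal C$ and every functor $[-,-]:\mathcal C^{\mathrm{op}}\times\mathcal C\to\mathcal V$, the assignment $\{m^n\}_{n\ge -1}\mapsto(\eta,\mu):=(m^{-1},m^1)$ is a bijection from the set of extended enrichment structures on $(\mathcal C,[-,-])$ to the set of abridged enrichment structures on $(\mathcal C,[-,-])$.
   Context: **Oplax monoidal category.** An oplax monoidal category $\mathcal V^\omega$ is a category $\mathcal V$ with functors $\omega^n:\mathcal V^{n+1}\to\mathcal V$ ($n\ge-1$), natural transformations (associators) $a^{p,q}_i:\omega^{p+q}\to\omega^p\circ(\mathrm{Id}^{i},\omega^q,\mathrm{Id}^{p-i})$ for $p\ge0$, $q\ge-1$, $0\le i\le p$ (abbreviated $\omega^{p+q}\to\omega^p(-,\omega^q,-)$), and a counit $\omega^0\to\mathrm{Id}$, such that (whenever they make sense): the composites $\omega^p\to\omega^0\omega^p\to\omega^p$ and $\omega^p\to\omega^p(-,\omega^0,-)\to\omega^p$ are identities; the two composites $\omega^{p+q+r}\to\omega^p(-,\omega^q,-,\omega^r,-)$ (through $\omega^{p+q}(-,\omega^r,-)$ and through $\omega^{p+r}(-,\omega^q,-)$) agree; the two composites $\omega^{p+q+r}\to\omega^p(-,\omega^q(-,\omega^r,-),-)$ (through $\omega^{p+q}(-,\omega^r,-)$ and through $\omega^p(-,\omega^{q+r},-)$) agree. Write $1_\omega=\omega^{-1}$, $x\otimes_\omega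 y=\omega^1(x,y)$, $x\otimes_\omega y\otimes_\omega z=\omega^2(x,y,z)$. **Extended structure.** A family of transformations, for $n\ge-1$, $$m^n:\ \omega^n([x_n,x_{n+1}],\dots,[x_0,x_1])\to[x_0,x_{n+1}]$$ (for $n=-1$: $1_\omega\to[x_0,x_0]$), natural in $x_0,x_{n+1}$ and extranatural in $x_1,\dots,x_n$ (for $n=-1$ extranatural in $x_0$), such that $m^0$ is the counit $\omega^0\to\mathrm{Id}$ evaluated at $[x_0,x_1]$, and for all $p\ge0,q\ge-1$ and all insertion positions, $m^{p+q}$ equals the composite of the associator $\omega^{p+q}\to\omega^p(-,\omega^q,-)$, then $\omega^p(-,m^q,-)$, then $m^p$. **Abridged structure.** A family $\eta_x:1_\omega\to[x,x]$ extranatural in $x$ and a family $\mu_{x,y,z}:[y,z]\otimes_\omega[x,y]\to[x,z]$ natural in $x,z$ and extranatural in $y$, such that: (associativity) the two composites $[y,z]\otimes_\omega[x,y]\otimes_\omega[w,x]\to([y,z]\otimes_\omega[x,y])\otimes_\omega[w,x]\to[x,z]\otimes_\omega[w,x]\to[w,z]$ and $[y,z]\otimes_\omega[x,y]\otimes_\omega[w,x]\to[y,z]\otimes_\omega([x,y]\otimes_\omega[w,x])\to[y,z]\otimes_\omega[w,y]\to[w,z]$ agree; (unitality) the composites $\omega^0([x,y])\to1_\omega\otimes_\omega[x,y]\xrightarrow{\eta_y\otimes-}[y,y]\otimes_\omega[x,y]\xrightarrow{\mu}[x,y]$ and $\omega^0([x,y])\to[x,y]\otimes_\omega1_\omega\xrightarrow{-\otimes\eta_x}[x,y]\otimes_\omega[x,x]\xrightarrow{\mu}[x,y]$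 both equal the counit. *)

theory Defs
  imports Main "HOL-Library.FuncSet"
begin

section \<open>Categories and functors\<close>

record ('o, 'a) cat_data =
  Ob :: "'o set"
  Ar :: "'a set"
  Dom :: "'a \<Rightarrow> 'o"
  Cod :: "'a \<Rightarrow> 'o"
  Id :: "'o \<Rightarrow> 'a"
  Comp :: "'a \<Rightarrow> 'a \<Rightarrow> 'a"  (infixr "\<odot>\<index>" 70)

text \<open>Composition is in applicative order: \<open>g \<odot> f\<close> is \<open>g\<close> after \<open>f\<close>.
  Its values on non-composable pairs are irrelevant.\<close>

definition hom :: "('o, 'a, 'z) cat_data_scheme \<Rightarrow> 'o \<Rightarrow> 'o \<Rightarrow> 'a set" where
  "hom C x y = {f \<in> Ar C. Dom C f = x \<and> Cod C f = y}"

locale category =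
  fixes C :: "('o, 'a, 'z) cat_data_scheme" (structure)
  assumes Dom_closed: "f \<in> Ar C \<Longrightarrow> Dom C f \<in> Ob C"
    and Cod_closed: "f \<in> Ar C \<Longrightarrow> Cod C f \<in> Ob C"
    and Id_hom: "x \<in> Ob C \<Longrightarrow> Id C x \<in> hom C x x"
    and Comp_hom: "\<lbrakk>f \<in> hom C x y; g \<in> hom C y z\<rbrakk> \<Longrightarrow> g \<odot> f \<in> hom C x z"
    and Comp_Id: "f \<in> hom C x y \<Longrightarrow> f \<odot> Id C x = f"
    and Id_Comp: "f \<in> hom C x y \<Longrightarrow> Id C y \<odot> f = f"
    and Comp_assoc: "\<lbrakk>f \<in> hom C w x; g \<in> hom C x y; h \<in> hom C y z\<rbrakk>
                      \<Longrightarrow> (h \<odot> g) \<odot> f = h \<odot> (g \<odot> f)"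

definition op_cat :: "('o, 'a, 'z) cat_data_scheme \<Rightarrow> ('o, 'a) cat_data" where
  "op_cat C = \<lparr>Ob = Ob C, Ar = Ar C, Dom = Cod C, Cod = Dom C, Id = Id C,
               Comp = (\<lambda>g f. f \<odot>\<^bsub>C\<^esub> g)\<rparr>"

definition prod_cat :: "('o, 'a, 'y) cat_data_scheme \<Rightarrow> ('p, 'b, 'z) cat_data_scheme
    \<Rightarrow> ('o \<times> 'p, 'a \<times> 'b) cat_data" where
  "prod_cat C D = \<lparr>Ob = Ob C \<times> Ob D, Ar = Ar C \<times> Ar D,
     Dom = (\<lambda>(f, g). (Dom C f, Dom D g)), Cod = (\<lambda>(f, g). (Cod C f, Cod D g)),
     Id = (\<lambda>(x, y). (Id C x, Id D y)),
     Comp = (\<lambda>(f', g') (f, g). (f' \<odot>\<^bsub>C\<^esub> f, g' \<odot>\<^bsub>D\<^esub> g))\<rparr>"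

text \<open>The \<open>k\<close>-fold power of a category; objects and arrows are lists of length \<open>k\<close>.\<close>

definition power_cat :: "nat \<Rightarrow> ('o, 'a, 'z) cat_data_scheme \<Rightarrow> ('o list, 'a list) cat_data" where
  "power_cat k C = \<lparr>Ob = {xs \<in> lists (Ob C). length xs = k}, Ar = {fs \<in> lists (Ar C). length fs = k},
     Dom = map (Dom C), Cod = map (Cod C), Id = map (Id C), Comp = map2 (Comp C)\<rparr>"

definition is_functor :: "('o, 'a, 'y) cat_data_scheme \<Rightarrow> ('p, 'b, 'z) cat_data_scheme
    \<Rightarrow> ('o \<Rightarrow> 'p) \<Rightarrow> ('a \<Rightarrow> 'b) \<Rightarrow> bool" where
  "is_functor C D FO FA \<longleftrightarrow>
     (\<forall>x \<in> Ob C. FO x \<in> Ob D) \<and>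
     (\<forall>f \<in> Ar C. FA f \<in> hom D (FO (Dom C f)) (FO (Cod C f))) \<and>
     (\<forall>x \<in> Ob C. FA (Id C x) = Id D (FO x)) \<and>
     (\<forall>f \<in> Ar C. \<forall>g \<in> Ar C. Cod C f = Dom C g \<longrightarrow> FA (g \<odot>\<^bsub>C\<^esub> f) = FA g \<odot>\<^bsub>D\<^esub> FA f)"

section \<open>Naturality and extranaturality\<close>

text \<open>These predicates contain only the commutation conditions; functors enter through their
  arrow maps, and that the components are arrows of the right type is required separately.
  In the two extranaturality conditions the functor is \<open>F : C\<^sup>o\<^sup>p \<times> C \<rightarrow> D\<close>; the family is
  \<open>F (x, x) \<rightarrow> d\<close> in the first one and \<open>d \<rightarrow> F (x, x)\<close> in the second one, for a fixed
  object \<open>d\<close> of \<open>D\<close>.\<close>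

definition natural :: "('o, 'a, 'y) cat_data_scheme \<Rightarrow> ('p, 'b, 'z) cat_data_scheme
    \<Rightarrow> ('a \<Rightarrow> 'b) \<Rightarrow> ('a \<Rightarrow> 'b) \<Rightarrow> ('o \<Rightarrow> 'b) \<Rightarrow> bool" where
  "natural C D F G \<alpha> \<longleftrightarrow>
     (\<forall>f \<in> Ar C. \<alpha> (Cod C f) \<odot>\<^bsub>D\<^esub> F f = G f \<odot>\<^bsub>D\<^esub> \<alpha> (Dom C f))"

definition extranatural_from :: "('o, 'a, 'y) cat_data_scheme \<Rightarrow> ('p, 'b, 'z) cat_data_scheme
    \<Rightarrow> ('a \<times> 'a \<Rightarrow> 'b) \<Rightarrow> ('o \<Rightarrow> 'b) \<Rightarrow> bool" where
  "extranatural_from C D F \<alpha> \<longleftrightarrow>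
     (\<forall>f \<in> Ar C. \<alpha> (Dom C f) \<odot>\<^bsub>D\<^esub> F (f, Id C (Dom C f)) = \<alpha> (Cod C f) \<odot>\<^bsub>D\<^esub> F (Id C (Cod C f), f))"

definition extranatural_to :: "('o, 'a, 'y) cat_data_scheme \<Rightarrow> ('p, 'b, 'z) cat_data_scheme
    \<Rightarrow> ('a \<times> 'a \<Rightarrow> 'b) \<Rightarrow> ('o \<Rightarrow> 'b) \<Rightarrow> bool" where
  "extranatural_to C D F \<alpha> \<longleftrightarrow>
     (\<forall>f \<in> Ar C. F (Id C (Dom C f), f) \<odot>\<^bsub>D\<^esub> \<alpha> (Dom C f) = F (f, Id C (Cod C f)) \<odot>\<^bsub>D\<^esub> \<alpha> (Cod C f))"

section \<open>Oplax monoidal categories\<close>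

text \<open>The functor \<open>\<omega>\<^sup>n\<close> (\<open>n \<ge> -1\<close>) is the restriction of \<open>TOb\<close>, \<open>TAr\<close> to lists of length
  \<open>n + 1\<close>; so \<open>TOb V []\<close> is the unit \<open>1\<^sub>\<omega>\<close>. The component of the associator \<open>a\<^sub>i\<^sup>p\<^sup>,\<^sup>q\<close> at a list of
  \<open>p + q + 1\<close> objects is \<open>Assoc V xs ys zs\<close>, where \<open>xs @ ys @ zs\<close> is that list, cut so that
  \<open>length xs = i\<close>, \<open>length ys = q + 1\<close>, \<open>length zs = p - i\<close>. Arbitrary \<open>xs\<close>, \<open>ys\<close>, \<open>zs\<close> correspond
  exactly to arbitrary \<open>p \<ge> 0\<close>, \<open>q \<ge> -1\<close>, \<open>0 \<le> i \<le> p\<close> and an arbitrary list of objects.\<close>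

record ('o, 'a) oplax_data = "('o, 'a) cat_data" +
  TOb :: "'o list \<Rightarrow> 'o"
  TAr :: "'a list \<Rightarrow> 'a"
  Assoc :: "'o list \<Rightarrow> 'o list \<Rightarrow> 'o list \<Rightarrow> 'a"
  Counit :: "'o \<Rightarrow> 'a"

abbreviation ids :: "('o, 'a, 'z) cat_data_scheme \<Rightarrow> 'o list \<Rightarrow> 'a list" where
  "ids C xs \<equiv> map (Id C) xs"

locale oplax_monoidal_category = category V
  for V :: "('o, 'a, 'z) oplax_data_scheme" (structure) +
  assumes T_functor: "is_functor (power_cat k V) V (TOb V) (TAr V)"
    and Assoc_hom: "\<lbrakk>xs \<in> lists (Ob V); ys \<in> lists (Ob V); zs \<in> lists (Ob V)\<rbrakk> \<Longrightarrow>
      Assoc V xs ys zs \<in> hom V (TOb V (xs @ ys @ zs)) (TOb V (xs @ [TOb V ys] @ zs))"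
    and Assoc_natural: "\<lbrakk>fs \<in> lists (Ar V); gs \<in> lists (Ar V); hs \<in> lists (Ar V)\<rbrakk> \<Longrightarrow>
      Assoc V (map (Cod V) fs) (map (Cod V) gs) (map (Cod V) hs) \<odot> TAr V (fs @ gs @ hs) =
      TAr V (fs @ [TAr V gs] @ hs) \<odot> Assoc V (map (Dom V) fs) (map (Dom V) gs) (map (Dom V) hs)"
    and Counit_hom: "x \<in> Ob V \<Longrightarrow> Counit V x \<in> hom V (TOb V [x]) x"
    and Counit_natural: "natural V V (\<lambda>f. TAr V [f]) (\<lambda>f. f) (Counit V)"
    and Counit_outer: "xs \<in> lists (Ob V) \<Longrightarrow>
      Counit V (TOb V xs) \<odot> Assoc V [] xs [] = Id V (TOb V xs)"
    and Counit_inner: "\<lbrakk>xs \<in> lists (Ob V); y \<in> Ob V; zs \<in> lists (Ob V)\<rbrakk> \<Longrightarrow>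
      TAr V (ids V xs @ [Counit V y] @ ids V zs) \<odot> Assoc V xs [y] zs = Id V (TOb V (xs @ [y] @ zs))"
    and Assoc_parallel:
      "\<lbrakk>us \<in> lists (Ob V); xs \<in> lists (Ob V); vs \<in> lists (Ob V); ys \<in> lists (Ob V); ws \<in> lists (Ob V)\<rbrakk> \<Longrightarrow>
      Assoc V us xs (vs @ [TOb V ys] @ ws) \<odot> Assoc V (us @ xs @ vs) ys ws =
      Assoc V (us @ [TOb V xs] @ vs) ys ws \<odot> Assoc V us xs (vs @ ys @ ws)"
    and Assoc_nested:
      "\<lbrakk>us \<in> lists (Ob V); xs \<in> lists (Ob V); ys \<in> lists (Ob V); zs \<in> lists (Ob V); ws \<in> lists (Ob V)\<rbrakk> \<Longrightarrow>
      Assoc V us (xs @ [TOb V ys] @ zs) ws \<odot> Assoc V (us @ xs) ys (zs @ ws) =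
      TAr V (ids V us @ [Assoc V xs ys zs] @ ids V ws) \<odot> Assoc V us (xs @ ys @ zs) ws"

section \<open>Enrichment structures\<close>

text \<open>\<open>homs H [x\<^sub>0, \<dots>, x\<^sub>n\<^sub>+\<^sub>1] = [H (x\<^sub>n, x\<^sub>n\<^sub>+\<^sub>1), \<dots>, H (x\<^sub>0, x\<^sub>1)]\<close>; note the reversal.\<close>

fun homs :: "('c \<times> 'c \<Rightarrow> 'o) \<Rightarrow> 'c list \<Rightarrow> 'o list" where
  "homs H (x # y # zs) = homs H (y # zs) @ [H (x, y)]"
| "homs H _ = []"

text \<open>An extended structure is a single function \<open>m\<close> whose value at a nonempty list
  \<open>[x\<^sub>0, \<dots>, x\<^sub>n\<^sub>+\<^sub>1]\<close> is the component of \<open>m\<^sup>n\<close> there. It is made \<open>undefined\<close> at all other lists, so that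
  equality of functions is equality of structures; similarly below. In the composition law,
  \<open>m\<^sup>q\<close> is applied to \<open>ys = [y\<^sub>0, \<dots>, y\<^sub>q\<^sub>+\<^sub>1]\<close>, the insertion position is \<open>i = length vs\<close>, and
  \<open>p = length us + length vs\<close>.\<close>

definition extended_structures ::
  "('o, 'a, 'y) oplax_data_scheme \<Rightarrow> ('c, 'f, 'z) cat_data_scheme
    \<Rightarrow> ('c \<times> 'c \<Rightarrow> 'o) \<Rightarrow> ('f \<times> 'f \<Rightarrow> 'a) \<Rightarrow> ('c list \<Rightarrow> 'a) set" where
  "extended_structures V C HO HA =
    {m \<in> (\<Pi>\<^sub>E xs \<in> lists (Ob C) - {[]}. hom V (TOb V (homs HO xs)) (HO (hd xs, last xs))).
      (\<forall>vs \<in> lists (Ob C) - {[]}.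
        natural (op_cat C) V
          (\<lambda>f. TAr V (ids V (homs HO vs) @ [HA (f, Id C (hd vs))]))
          (\<lambda>f. HA (f, Id C (last vs)))
          (\<lambda>x. m ([x] @ vs))) \<and>
      (\<forall>us \<in> lists (Ob C) - {[]}.
        natural C V
          (\<lambda>g. TAr V ([HA (Id C (last us), g)] @ ids V (homs HO us)))
          (\<lambda>g. HA (Id C (hd us), g))
          (\<lambda>x. m (us @ [x]))) \<and>
      (\<forall>us \<in> lists (Ob C) - {[]}. \<forall>vs \<in> lists (Ob C) - {[]}.
        extranatural_from C V
          (\<lambda>(f, g). TAr V (ids V (homs HO vs) @
             [HA (f, Id C (hd vs)), HA (Id C (last us), g)] @ ids V (homs HO us)))
          (\<lambda>x. m (us @ [x] @ vs))) \<and>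
      extranatural_to C V HA (\<lambda>x. m [x]) \<and>
      (\<forall>x \<in> Ob C. \<forall>y \<in> Ob C. m [x, y] = Counit V (HO (x, y))) \<and>
      (\<forall>us \<in> lists (Ob C). \<forall>ys \<in> lists (Ob C) - {[]}. \<forall>vs \<in> lists (Ob C).
        m (us @ ys @ vs) =
          m (us @ [hd ys, last ys] @ vs) \<odot>\<^bsub>V\<^esub>
          (TAr V (ids V (homs HO ([last ys] @ vs)) @ [m ys] @ ids V (homs HO (us @ [hd ys]))) \<odot>\<^bsub>V\<^esub>
           Assoc V (homs HO ([last ys] @ vs)) (homs HO ys) (homs HO (us @ [hd ys]))))}"

definition abridged_structures ::
  "('o, 'a, 'y) oplax_data_scheme \<Rightarrow> ('c, 'f, 'z) cat_data_scheme
    \<Rightarrow> ('c \<times> 'c \<Rightarrow> 'o) \<Rightarrow> ('f \<times> 'f \<Rightarrow> 'a) \<Rightarrow> (('c \<Rightarrow> 'a) \<times> ('c \<times> 'c \<times> 'c \<Rightarrow> 'a)) set" where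
  "abridged_structures V C HO HA =
    {(\<eta>, \<mu>).
      \<eta> \<in> (\<Pi>\<^sub>E x \<in> Ob C. hom V (TOb V []) (HO (x, x))) \<and>
      \<mu> \<in> (\<Pi>\<^sub>E (x, y, z) \<in> Ob C \<times> Ob C \<times> Ob C. hom V (TOb V [HO (y, z), HO (x, y)]) (HO (x, z))) \<and>
      extranatural_to C V HA \<eta> \<and>
      (\<forall>y \<in> Ob C. \<forall>z \<in> Ob C.
        natural (op_cat C) V
          (\<lambda>f. TAr V [Id V (HO (y, z)), HA (f, Id C y)])
          (\<lambda>f. HA (f, Id C z))
          (\<lambda>x. \<mu> (x, y, z))) \<and>
      (\<forall>x \<in> Ob C. \<forall>y \<in> Ob C.
        natural C V
          (\<lambda>g. TAr V [HA (Id C y, g), Id V (HO (x, y))])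
          (\<lambda>g. HA (Id C x, g))
          (\<lambda>z. \<mu> (x, y, z))) \<and>
      (\<forall>x \<in> Ob C. \<forall>z \<in> Ob C.
        extranatural_from C V
          (\<lambda>(f, g). TAr V [HA (f, Id C z), HA (Id C x, g)])
          (\<lambda>y. \<mu> (x, y, z))) \<and>
      (\<forall>w \<in> Ob C. \<forall>x \<in> Ob C. \<forall>y \<in> Ob C. \<forall>z \<in> Ob C.
        \<mu> (w, x, z) \<odot>\<^bsub>V\<^esub> (TAr V [\<mu> (x, y, z), Id V (HO (w, x))] \<odot>\<^bsub>V\<^esub>
          Assoc V [] [HO (y, z), HO (x, y)] [HO (w, x)]) =
        \<mu> (w, y, z) \<odot>\<^bsub>V\<^esub> (TAr V [Id V (HO (y, z)), \<mu> (w, x, y)] \<odot>\<^bsub>V\<^esub>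
          Assoc V [HO (y, z)] [HO (x, y), HO (w, x)] [])) \<and>
      (\<forall>x \<in> Ob C. \<forall>y \<in> Ob C.
        \<mu> (x, y, y) \<odot>\<^bsub>V\<^esub> (TAr V [\<eta> y, Id V (HO (x, y))] \<odot>\<^bsub>V\<^esub> Assoc V [] [] [HO (x, y)]) =
          Counit V (HO (x, y)) \<and>
        \<mu> (x, x, y) \<odot>\<^bsub>V\<^esub> (TAr V [Id V (HO (x, y)), \<eta> x] \<odot>\<^bsub>V\<^esub> Assoc V [HO (x, y)] [] []) =
          Counit V (HO (x, y)))}"

definition abridge :: "('c, 'f, 'z) cat_data_scheme \<Rightarrow> ('c list \<Rightarrow> 'a)
    \<Rightarrow> ('c \<Rightarrow> 'a) \<times> ('c \<times> 'c \<times> 'c \<Rightarrow> 'a)" where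
  "abridge C m = ((\<lambda>x \<in> Ob C. m [x]), (\<lambda>(x, y, z) \<in> Ob C \<times> Ob C \<times> Ob C. m [x, y, z]))"

end

(* Reading an arrow TOb V Y -> z as a multimorphism Y -> z turns an oplax monoidal category into
   a multicategory: partial composites insert an associator, the identities are the counits, and
   the two associator axioms are the sequential and parallel associativity of partial composition.
   In this language an extended structure is a family of multimorphisms closed under all partial
   composites, an abridged one its binary and nullary part. Hence m is determined by the recursion
   m (x0, x1, ..., xn) = mu (x0, x1, xn) o_1 m (x1, ..., xn), and the general composition law
   follows by induction from associativity and unitality. Once that law is known, each naturality
   condition on m reduces to the one for mu by exposing a single mu at the relevant variable. *)

theory Submission
  imports Defs
begin

section \<open>Rewriting rules for arrows, identities and lists of identities\<close>

context category
begin

lemma hom_ArD: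
  assumes "f \<in> hom C x y"
  shows "f \<in> Ar C" "Dom C f = x" "Cod C f = y"
  using assms by (auto simp: hom_def)

lemma hom_ObD:
  assumes "f \<in> hom C x y"
  shows "x \<in> Ob C" "y \<in> Ob C"
  using assms Dom_closed Cod_closed by (auto simp: hom_def)

lemma Id_Ar [simp]:
  assumes "x \<in> Ob C"
  shows "Id C x \<in> Ar C" "Dom C (Id C x) = x" "Cod C (Id C x) = x"
  using hom_ArD[OF Id_hom[OF assms]] by auto

lemma Comp_Ar [simp]:
  assumes "f \<in> Ar C" "g \<in> Ar C" "Cod C f = Dom C g"
  shows "g \<odot> f \<in> Ar C" "Dom C (g \<odot> f) = Dom C f" "Cod C (g \<odot> f) = Cod C g"
  using hom_ArD[OF Comp_hom[of f "Dom C f" "Cod C f" g "Cod C g"]] assms by (auto simp: hom_def)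

lemma Comp_assoc_Ar:
  assumes "f \<in> Ar C" "g \<in> Ar C" "h \<in> Ar C" "Cod C f = Dom C g" "Cod C g = Dom C h"
  shows "(h \<odot> g) \<odot> f = h \<odot> (g \<odot> f)"
  using Comp_assoc assms by (auto simp: hom_def)

lemma Comp_Id_Ar [simp]: "f \<in> Ar C \<Longrightarrow> Dom C f = x \<Longrightarrow> f \<odot> Id C x = f"
  using Comp_Id by (auto simp: hom_def)

lemma Id_Comp_Ar [simp]: "f \<in> Ar C \<Longrightarrow> Cod C f = x \<Longrightarrow> Id C x \<odot> f = f"
  using Id_Comp by (auto simp: hom_def)

lemma ids_in_lists [simp]: "xs \<in> lists (Ob C) \<Longrightarrow> ids C xs \<in> lists (Ar C)"
  by (induction xs) auto

lemma map_Dom_ids [simp]: "xs \<in> lists (Ob C) \<Longrightarrow> map (Dom C) (ids C xs) = xs"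
  by (induction xs) auto

lemma map_Cod_ids [simp]: "xs \<in> lists (Ob C) \<Longrightarrow> map (Cod C) (ids C xs) = xs"
  by (induction xs) auto

lemma map2_Comp_ids [simp]:
  "xs \<in> lists (Ob C) \<Longrightarrow> map2 (Comp C) (ids C xs) (ids C xs) = ids C xs"
  by (induction xs) auto

end

section \<open>The multicategory underlying an oplax monoidal category\<close>

context oplax_monoidal_category
begin

lemma TOb_closed [simp]: "xs \<in> lists (Ob V) \<Longrightarrow> TOb V xs \<in> Ob V"
  using T_functor[of "length xs"] by (auto simp: is_functor_def power_cat_def)

lemma TAr_Ar [simp]:
  assumes "fs \<in> lists (Ar V)"
  shows "TAr V fs \<in> Ar V" "Dom V (TAr V fs) = TOb V (map (Dom V) fs)"
    "Cod V (TAr V fs) = TOb V (map (Cod V) fs)"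
  using T_functor[of "length fs"] assms by (auto simp: is_functor_def power_cat_def hom_def)

lemma TAr_ids [simp]: "xs \<in> lists (Ob V) \<Longrightarrow> TAr V (ids V xs) = Id V (TOb V xs)"
  using T_functor[of "length xs"] by (auto simp: is_functor_def power_cat_def)

lemma TAr_Comp:
  assumes "fs \<in> lists (Ar V)" "gs \<in> lists (Ar V)" "map (Cod V) fs = map (Dom V) gs"
  shows "TAr V gs \<odot> TAr V fs = TAr V (map2 (Comp V) gs fs)"
proof -
  \<comment> \<open>\<open>T_functor\<close> speaks about one power of \<open>V\<close> at a time,
    so both lists must be placed in the same power. Matching boundaries force this.\<close>
  have "length gs = length fs"
    using assms(3) by (metis length_map)
  then show ?thesis
    using T_functor[of "length fs"] assms by (auto simp: is_functor_def power_cat_def)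
qed

lemma Assoc_Ar [simp]:
  assumes "xs \<in> lists (Ob V)" "ys \<in> lists (Ob V)" "zs \<in> lists (Ob V)"
  shows "Assoc V xs ys zs \<in> Ar V" "Dom V (Assoc V xs ys zs) = TOb V (xs @ ys @ zs)"
    "Cod V (Assoc V xs ys zs) = TOb V (xs @ TOb V ys # zs)"
  using hom_ArD[OF Assoc_hom[OF assms]] by auto

lemma Counit_Ar [simp]:
  assumes "x \<in> Ob V"
  shows "Counit V x \<in> Ar V" "Dom V (Counit V x) = TOb V [x]" "Cod V (Counit V x) = x"
  using hom_ArD[OF Counit_hom[OF assms]] by auto

lemma Counit_TAr: "f \<in> hom V x y \<Longrightarrow> Counit V y \<odot> TAr V [f] = f \<odot> Counit V x"
  using Counit_natural by (auto simp: natural_def hom_def)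

text \<open>This is the whiskering written \<open>omega^p(-, f, -)\<close> in the axioms, with the
  untouched objects \<open>P\<close> and \<open>Q\<close> made explicit.\<close>

definition ins :: "'o list \<Rightarrow> 'a \<Rightarrow> 'o list \<Rightarrow> 'a" where
  "ins P f Q = TAr V (ids V P @ [f] @ ids V Q)"

lemma ins_Ar [simp]:
  assumes "P \<in> lists (Ob V)" "Q \<in> lists (Ob V)" "f \<in> Ar V"
  shows "ins P f Q \<in> Ar V" "Dom V (ins P f Q) = TOb V (P @ Dom V f # Q)"
    "Cod V (ins P f Q) = TOb V (P @ Cod V f # Q)"
  using assms map_Dom_ids map_Cod_ids by (auto simp: ins_def simp del: map_map)

lemma ins_Comp:
  assumes "P \<in> lists (Ob V)" "Q \<in> lists (Ob V)" "f \<in> Ar V" "g \<in> Ar V" "Cod V f = Dom V g"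
  shows "ins P (g \<odot> f) Q = ins P g Q \<odot> ins P f Q"
  using assms by (simp add: ins_def TAr_Comp del: map_map)

text \<open>The two arrows sit in different slots, so by functoriality both composites are
  \<open>TAr\<close> of the one list that contains \<open>f\<close> and \<open>g\<close>.\<close>

lemma ins_interchange:
  assumes "U \<in> lists (Ob V)" "W \<in> lists (Ob V)" "X \<in> lists (Ob V)"
    and "f \<in> hom V a a'" "g \<in> hom V b b'"
  shows "ins U f (W @ [b'] @ X) \<odot> ins (U @ [a] @ W) g X
       = ins (U @ [a'] @ W) g X \<odot> ins U f (W @ [b] @ X)"
  using assms hom_ArD[OF assms(4)] hom_ArD[OF assms(5)] hom_ObD[OF assms(4)] hom_ObD[OF assms(5)]
  by (simp add: ins_def TAr_Comp del: map_map)

text \<open>This lemma and the next two specialize the naturality of the associator to identities in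
  all but one of its three blocks: the inserted block here, then the left and the right one.\<close>

lemma Assoc_ins_inner:
  assumes "P \<in> lists (Ob V)" "Q \<in> lists (Ob V)" "gs \<in> lists (Ar V)"
  shows "Assoc V P (map (Cod V) gs) Q \<odot> TAr V (ids V P @ gs @ ids V Q)
       = ins P (TAr V gs) Q \<odot> Assoc V P (map (Dom V) gs) Q"
  using Assoc_natural[of "ids V P" gs "ids V Q"] assms
  by (simp add: ins_def del: map_map)

lemma Assoc_ins_left:
  assumes "U \<in> lists (Ob V)" "W \<in> lists (Ob V)" "Y \<in> lists (Ob V)" "Q \<in> lists (Ob V)"
    and "f \<in> hom V a a'"
  shows "Assoc V (U @ [a'] @ W) Y Q \<odot> ins U f (W @ Y @ Q)
       = ins U f (W @ [TOb V Y] @ Q) \<odot> Assoc V (U @ [a] @ W) Y Q"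
  using Assoc_natural[of "ids V U @ [f] @ ids V W" "ids V Y" "ids V Q"] assms hom_ArD[OF assms(5)]
  by (simp add: ins_def del: map_map)

lemma Assoc_ins_right:
  assumes "U \<in> lists (Ob V)" "W \<in> lists (Ob V)" "Y \<in> lists (Ob V)" "P \<in> lists (Ob V)"
    and "f \<in> hom V a a'"
  shows "Assoc V P Y (U @ [a'] @ W) \<odot> ins (P @ Y @ U) f W
       = ins (P @ [TOb V Y] @ U) f W \<odot> Assoc V P Y (U @ [a] @ W)"
  using Assoc_natural[of "ids V P" "ids V Y" "ids V U @ [f] @ ids V W"] assms hom_ArD[OF assms(5)]
  by (simp add: ins_def del: map_map)

text \<open>Arrows \<open>TOb V Y \<rightarrow> z\<close> are regarded as multimorphisms \<open>Y \<rightarrow> z\<close>. Partial composition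
  plugs \<open>f : Y \<rightarrow> z\<close> into the slot \<open>z\<close> of \<open>g : P @ [z] @ Q \<rightarrow> w\<close>; the identities are the
  counits.\<close>

definition pcomp :: "'a \<Rightarrow> 'o list \<Rightarrow> 'o list \<Rightarrow> 'a \<Rightarrow> 'o list \<Rightarrow> 'a" where
  "pcomp g P Y f Q = g \<odot> (ins P f Q \<odot> Assoc V P Y Q)"

lemma pcomp_hom:
  assumes "P \<in> lists (Ob V)" "Q \<in> lists (Ob V)" "Y \<in> lists (Ob V)"
    and "f \<in> hom V (TOb V Y) z" "g \<in> hom V (TOb V (P @ [z] @ Q)) w"
  shows "pcomp g P Y f Q \<in> hom V (TOb V (P @ Y @ Q)) w"
  using assms hom_ArD[OF assms(4)] hom_ArD[OF assms(5)]
  by (simp add: pcomp_def hom_def)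

text \<open>Left unit law of the multicategory: naturality lets \<open>f\<close> pass the counit,
  and the axiom \<open>Counit_outer\<close> removes what remains.\<close>

lemma pcomp_Counit_left:
  assumes "Y \<in> lists (Ob V)" "f \<in> hom V (TOb V Y) z"
  shows "pcomp (Counit V z) [] Y f [] = f"
proof -
  note f = hom_ArD[OF assms(2)] hom_ObD[OF assms(2)]
  have "pcomp (Counit V z) [] Y f [] = (Counit V z \<odot> TAr V [f]) \<odot> Assoc V [] Y []"
    using assms(1) f by (simp add: pcomp_def ins_def Comp_assoc_Ar)
  also have "\<dots> = f \<odot> (Counit V (TOb V Y) \<odot> Assoc V [] Y [])"
    using assms(1) f by (simp add: Counit_TAr[OF assms(2)] Comp_assoc_Ar)
  finally show ?thesis
    using assms(1) f by (simp add: Counit_outer)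
qed

lemma pcomp_Counit_right:
  assumes "P \<in> lists (Ob V)" "Q \<in> lists (Ob V)" "z \<in> Ob V"
    and "g \<in> hom V (TOb V (P @ [z] @ Q)) w"
  shows "pcomp g P [z] (Counit V z) Q = g"
  using Counit_inner[OF assms(1,3,2)] hom_ArD[OF assms(4)] by (simp add: pcomp_def ins_def)

text \<open>Sequential associativity. \<open>Assoc_nested\<close> exchanges the two ways of
  inserting a block inside a block; naturality in the inserted block then carries \<open>e\<close>
  past the outer associator.\<close>

lemma pcomp_nested:
  assumes lists: "U \<in> lists (Ob V)" "X \<in> lists (Ob V)" "Y \<in> lists (Ob V)" "Z \<in> lists (Ob V)"
      "W \<in> lists (Ob V)"
    and e: "e \<in> hom V (TOb V Y) y"
    and f: "f \<in> hom V (TOb V (X @ [y] @ Z)) z"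
    and g: "g \<in> hom V (TOb V (U @ [z] @ W)) w"
  shows "pcomp g U (X @ Y @ Z) (pcomp f X Y e Z) W
       = pcomp (pcomp g U (X @ [y] @ Z) f W) (U @ X) Y e (Z @ W)"
proof -
  note ar = lists hom_ArD[OF e] hom_ArD[OF f] hom_ArD[OF g] hom_ObD[OF e]
  let ?A = "Assoc V U (X @ Y @ Z) W"
  have "pcomp g U (X @ Y @ Z) (pcomp f X Y e Z) W
      = g \<odot> (ins U f W \<odot> (ins U (ins X e Z) W \<odot> (ins U (Assoc V X Y Z) W \<odot> ?A)))"
    using ar by (simp add: pcomp_def ins_Comp Comp_assoc_Ar)
  also have "ins U (Assoc V X Y Z) W \<odot> ?A
      = Assoc V U (X @ [TOb V Y] @ Z) W \<odot> Assoc V (U @ X) Y (Z @ W)"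
    using Assoc_nested[OF lists] by (simp add: ins_def)
  also have "ins U (ins X e Z) W \<odot> (Assoc V U (X @ [TOb V Y] @ Z) W \<odot> Assoc V (U @ X) Y (Z @ W))
      = (ins U (ins X e Z) W \<odot> Assoc V U (X @ [TOb V Y] @ Z) W) \<odot> Assoc V (U @ X) Y (Z @ W)"
    using ar by (simp add: Comp_assoc_Ar)
  also have "ins U (ins X e Z) W \<odot> Assoc V U (X @ [TOb V Y] @ Z) W
      = Assoc V U (X @ [y] @ Z) W \<odot> ins (U @ X) e (Z @ W)"
    using Assoc_ins_inner[of U W "ids V X @ [e] @ ids V Z"] ar
    by (simp add: ins_def del: map_map)
  finally show ?thesis
    using ar by (simp add: pcomp_def Comp_assoc_Ar)
qed

text \<open>Plugging into two disjoint slots commutes. Besides \<open>Assoc_parallel\<close>, the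
  whiskered \<open>e\<close> must pass the associator for \<open>X\<close>, then the whiskered
  \<open>f\<close> by interchange, and \<open>f\<close> must pass the associator for
  \<open>Y\<close>.\<close>

lemma pcomp_parallel:
  assumes lists: "U \<in> lists (Ob V)" "X \<in> lists (Ob V)" "Z \<in> lists (Ob V)" "Y \<in> lists (Ob V)"
      "W \<in> lists (Ob V)"
    and f: "f \<in> hom V (TOb V X) a"
    and e: "e \<in> hom V (TOb V Y) b"
    and g: "g \<in> hom V (TOb V (U @ [a] @ Z @ [b] @ W)) w"
  shows "pcomp (pcomp g U X f (Z @ [b] @ W)) (U @ X @ Z) Y e W
       = pcomp (pcomp g (U @ [a] @ Z) Y e W) U X f (Z @ Y @ W)"
proof -
  note ar = lists hom_ArD[OF e] hom_ArD[OF f] hom_ArD[OF g] hom_ObD[OF e] hom_ObD[OF f]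
  let ?A = "Assoc V (U @ X @ Z) Y W" and ?B = "Assoc V U X (Z @ Y @ W)"
    and ?A' = "Assoc V (U @ [TOb V X] @ Z) Y W"
  have "pcomp (pcomp g U X f (Z @ [b] @ W)) (U @ X @ Z) Y e W
      = g \<odot> (ins U f (Z @ [b] @ W) \<odot> ((Assoc V U X (Z @ [b] @ W) \<odot> ins (U @ X @ Z) e W) \<odot> ?A))"
    using ar by (simp add: pcomp_def Comp_assoc_Ar)
  also have "Assoc V U X (Z @ [b] @ W) \<odot> ins (U @ X @ Z) e W
      = ins (U @ [TOb V X] @ Z) e W \<odot> Assoc V U X (Z @ [TOb V Y] @ W)"
    using Assoc_ins_right[OF lists(3,5,2,1) e] .
  also have "(ins (U @ [TOb V X] @ Z) e W \<odot> Assoc V U X (Z @ [TOb V Y] @ W)) \<odot> ?A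
      = ins (U @ [TOb V X] @ Z) e W \<odot> (Assoc V U X (Z @ [TOb V Y] @ W) \<odot> ?A)"
    using ar by (simp add: Comp_assoc_Ar)
  also have "Assoc V U X (Z @ [TOb V Y] @ W) \<odot> ?A = ?A' \<odot> ?B"
    using Assoc_parallel[OF lists] .
  also have "ins U f (Z @ [b] @ W) \<odot> (ins (U @ [TOb V X] @ Z) e W \<odot> (?A' \<odot> ?B))
      = (ins U f (Z @ [b] @ W) \<odot> ins (U @ [TOb V X] @ Z) e W) \<odot> (?A' \<odot> ?B)"
    using ar by (simp add: Comp_assoc_Ar)
  also have "ins U f (Z @ [b] @ W) \<odot> ins (U @ [TOb V X] @ Z) e W
      = ins (U @ [a] @ Z) e W \<odot> ins U f (Z @ [TOb V Y] @ W)"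
    using ins_interchange[OF lists(1,3,5) f e] .
  also have "(ins (U @ [a] @ Z) e W \<odot> ins U f (Z @ [TOb V Y] @ W)) \<odot> (?A' \<odot> ?B)
      = ins (U @ [a] @ Z) e W \<odot> ((ins U f (Z @ [TOb V Y] @ W) \<odot> ?A') \<odot> ?B)"
    using ar by (simp add: Comp_assoc_Ar)
  also have "ins U f (Z @ [TOb V Y] @ W) \<odot> ?A'
      = Assoc V (U @ [a] @ Z) Y W \<odot> ins U f (Z @ Y @ W)"
    using Assoc_ins_left[OF lists(1,3,4,5) f] by simp
  finally show ?thesis
    using ar by (simp add: pcomp_def Comp_assoc_Ar)
qed

section \<open>Partial composites with ordinary arrows attached to the output or to inputs\<close>

lemma Comp_pcomp:
  assumes "P \<in> lists (Ob V)" "Q \<in> lists (Ob V)" "Y \<in> lists (Ob V)"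
    and "f \<in> hom V (TOb V Y) z" "g \<in> hom V (TOb V (P @ [z] @ Q)) w" "h \<in> hom V w v"
  shows "h \<odot> pcomp g P Y f Q = pcomp (h \<odot> g) P Y f Q"
  using assms(1-3) hom_ArD[OF assms(4)] hom_ArD[OF assms(5)] hom_ArD[OF assms(6)]
  by (simp add: pcomp_def Comp_assoc_Ar)

text \<open>Arrows at the inputs that belong to \<open>f\<close> can be absorbed into
  \<open>f\<close>, by naturality of the associator in the inserted block.\<close>

lemma pcomp_TAr_inner:
  assumes "P \<in> lists (Ob V)" "Q \<in> lists (Ob V)" "gs \<in> lists (Ar V)"
    and "f \<in> hom V (TOb V (map (Cod V) gs)) z" "g \<in> hom V (TOb V (P @ [z] @ Q)) w"
  shows "pcomp g P (map (Cod V) gs) f Q \<odot> TAr V (ids V P @ gs @ ids V Q)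
       = pcomp g P (map (Dom V) gs) (f \<odot> TAr V gs) Q"
proof -
  have [simp]: "map (Dom V) gs \<in> lists (Ob V)" "map (Cod V) gs \<in> lists (Ob V)"
    using assms(3) Dom_closed Cod_closed by (auto simp: in_lists_conv_set)
  note ar = assms(1-3) hom_ArD[OF assms(4)] hom_ArD[OF assms(5)]
  have "pcomp g P (map (Cod V) gs) f Q \<odot> TAr V (ids V P @ gs @ ids V Q)
      = g \<odot> (ins P f Q \<odot> (Assoc V P (map (Cod V) gs) Q \<odot> TAr V (ids V P @ gs @ ids V Q)))"
    using ar by (simp add: pcomp_def Comp_assoc_Ar del: map_map)
  then show ?thesis
    using ar by (simp add: Assoc_ins_inner pcomp_def ins_Comp Comp_assoc_Ar)
qed

text \<open>Here \<open>h\<close> enters an input that still belongs to \<open>g\<close>, left of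
  the plugged block, and can be absorbed into \<open>g\<close>: it passes the associator by
  naturality and the whiskered \<open>f\<close> by interchange. The next lemma is the mirror
  image.\<close>

lemma pcomp_ins_left:
  assumes "P \<in> lists (Ob V)" "Y \<in> lists (Ob V)" "h \<in> hom V a a'" "Q \<in> lists (Ob V)"
    "U \<in> lists (Ob V)"
    and "f \<in> hom V (TOb V Y) z" "g \<in> hom V (TOb V (P @ [a'] @ U @ [z] @ Q)) w"
  shows "pcomp g (P @ [a'] @ U) Y f Q \<odot> ins P h (U @ Y @ Q)
       = pcomp (g \<odot> ins P h (U @ [z] @ Q)) (P @ [a] @ U) Y f Q"
proof -
  note ar = assms(1,2,4,5) hom_ArD[OF assms(3)] hom_ArD[OF assms(6)] hom_ArD[OF assms(7)]
    hom_ObD[OF assms(3)] hom_ObD[OF assms(6)]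
  have "pcomp g (P @ [a'] @ U) Y f Q \<odot> ins P h (U @ Y @ Q)
      = g \<odot> (ins (P @ [a'] @ U) f Q \<odot> (Assoc V (P @ [a'] @ U) Y Q \<odot> ins P h (U @ Y @ Q)))"
    using ar by (simp add: pcomp_def Comp_assoc_Ar)
  also have "\<dots> = g \<odot> ((ins (P @ [a'] @ U) f Q \<odot> ins P h (U @ [TOb V Y] @ Q))
      \<odot> Assoc V (P @ [a] @ U) Y Q)"
    using ar by (simp only: Assoc_ins_left[OF assms(1,5,2,4,3)]) (simp add: Comp_assoc_Ar)
  finally show ?thesis
    using ar by (simp only: ins_interchange[OF assms(1,5,4,3,6), symmetric])
      (simp add: pcomp_def Comp_assoc_Ar)
qed

lemma pcomp_ins_right:
  assumes "P \<in> lists (Ob V)" "Y \<in> lists (Ob V)" "h \<in> hom V a a'" "Q \<in> lists (Ob V)"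
    "U \<in> lists (Ob V)"
    and "f \<in> hom V (TOb V Y) z" "g \<in> hom V (TOb V (P @ [z] @ U @ [a'] @ Q)) w"
  shows "pcomp g P Y f (U @ [a'] @ Q) \<odot> ins (P @ Y @ U) h Q
       = pcomp (g \<odot> ins (P @ [z] @ U) h Q) P Y f (U @ [a] @ Q)"
proof -
  note ar = assms(1,2,4,5) hom_ArD[OF assms(3)] hom_ArD[OF assms(6)] hom_ArD[OF assms(7)]
    hom_ObD[OF assms(3)] hom_ObD[OF assms(6)]
  have "pcomp g P Y f (U @ [a'] @ Q) \<odot> ins (P @ Y @ U) h Q
      = g \<odot> (ins P f (U @ [a'] @ Q) \<odot> (Assoc V P Y (U @ [a'] @ Q) \<odot> ins (P @ Y @ U) h Q))"
    using ar by (simp add: pcomp_def Comp_assoc_Ar)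
  also have "\<dots> = g \<odot> ((ins P f (U @ [a'] @ Q) \<odot> ins (P @ [TOb V Y] @ U) h Q)
      \<odot> Assoc V P Y (U @ [a] @ Q))"
    using ar by (simp only: Assoc_ins_right[OF assms(5,4,2,1,3)]) (simp add: Comp_assoc_Ar)
  finally show ?thesis
    using ar by (simp only: ins_interchange[OF assms(1,5,4,6,3)])
      (simp add: pcomp_def Comp_assoc_Ar)
qed

end

section \<open>Enrichments as families of multimorphisms\<close>

lemma homs_Cons: "zs \<noteq> [] \<Longrightarrow> homs H (x # zs) = homs H zs @ [H (x, hd zs)]"
  by (cases zs) auto

lemma homs_append: "homs H (us @ x # vs) = homs H (x # vs) @ homs H (us @ [x])"
proof (induction us)
  case (Cons u us)
  then show ?case by (cases us) auto
qed simp

text \<open>Cuts the inputs into the three blocks that \<open>Assoc\<close> expects; because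
  \<open>homs\<close> reverses, \<open>vs\<close> lands on the left. Neighbouring pieces share an
  endpoint of \<open>ys\<close>. For a singleton \<open>ys\<close> the middle block is empty, which
  is the case \<open>q = -1\<close>.\<close>

lemma homs_split:
  assumes "ys \<noteq> []"
  shows "homs H (us @ ys @ vs) = homs H (last ys # vs) @ homs H ys @ homs H (us @ [hd ys])"
proof -
  have "homs H (us @ ys @ vs) = homs H (ys @ vs) @ homs H (us @ [hd ys])"
    using homs_append[of H us "hd ys" "tl ys @ vs"] assms by (cases ys) auto
  moreover have "homs H (ys @ vs) = homs H (last ys # vs) @ homs H ys"
    using homs_append[of H "butlast ys" "last ys" vs] append_butlast_last_id[OF assms]
    by (metis append_Cons append_Nil append_assoc)
  ultimately show ?thesis
    by simp
qed

section \<open>Enrichment structures in terms of partial composition\<close>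

locale enrichment_functor = oplax_monoidal_category V + C: category C
  for V :: "('o, 'a, 'y) oplax_data_scheme" (structure)
    and C :: "('c, 'f, 'z) cat_data_scheme" +
  fixes HO :: "'c \<times> 'c \<Rightarrow> 'o" and HA :: "'f \<times> 'f \<Rightarrow> 'a"
  assumes H_functor: "is_functor (prod_cat (op_cat C) C) V HO HA"
begin

lemma HO_closed [simp]: "x \<in> Ob C \<Longrightarrow> y \<in> Ob C \<Longrightarrow> HO (x, y) \<in> Ob V"
  using H_functor by (auto simp: is_functor_def prod_cat_def op_cat_def)

lemma HA_hom:
  "f \<in> Ar C \<Longrightarrow> g \<in> Ar C \<Longrightarrow> HA (f, g) \<in> hom V (HO (Cod C f, Dom C g)) (HO (Dom C f, Cod C g))"
  using H_functor by (auto simp: is_functor_def prod_cat_def op_cat_def)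

lemma homs_closed [simp]: "xs \<in> lists (Ob C) \<Longrightarrow> homs HO xs \<in> lists (Ob V)"
  by (induction xs rule: induct_list012) auto

lemma homs_snoc_closed [simp]:
  "xs \<in> lists (Ob C) \<Longrightarrow> x \<in> Ob C \<Longrightarrow> homs HO (xs @ [x]) \<in> lists (Ob V)"
  by (intro homs_closed) simp

lemma hd_last_closed [simp]:
  assumes "xs \<in> lists (Ob C)" "xs \<noteq> []"
  shows "hd xs \<in> Ob C" "last xs \<in> Ob C"
  using assms by (auto simp: in_lists_conv_set)

text \<open>The composition law of an extended structure, read as closure under partial composites.
  For \<open>ys = [y]\<close> the outer list contains \<open>y\<close> twice, and the nullary
  \<open>m [y]\<close> fills the slot \<open>HO (y, y)\<close>.\<close>

definition composes :: "('c list \<Rightarrow> 'a) \<Rightarrow> bool" where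
  "composes m \<longleftrightarrow> (\<forall>us \<in> lists (Ob C). \<forall>ys \<in> lists (Ob C) - {[]}. \<forall>vs \<in> lists (Ob C).
     m (us @ ys @ vs) = pcomp (m (us @ [hd ys, last ys] @ vs))
       (homs HO ([last ys] @ vs)) (homs HO ys) (m ys) (homs HO (us @ [hd ys])))"

lemma composesD:
  assumes "composes m" "us \<in> lists (Ob C)" "ys \<in> lists (Ob C)" "ys \<noteq> []" "vs \<in> lists (Ob C)"
  shows "m (us @ ys @ vs) = pcomp (m (us @ [hd ys, last ys] @ vs))
       (homs HO (last ys # vs)) (homs HO ys) (m ys) (homs HO (us @ [hd ys]))"
  using assms by (auto simp: composes_def)

text \<open>The instance that peels off the first object; it determines \<open>m\<close> from its
  values on lists of length one and three.\<close>

lemma composes_Cons: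
  assumes "composes m" "x \<in> Ob C" "zs \<in> lists (Ob C)" "zs \<noteq> []"
  shows "m (x # zs) = pcomp (m [x, hd zs, last zs]) [] (homs HO zs) (m zs) [HO (x, hd zs)]"
  using composesD[OF assms(1), of "[x]" zs "[]"] assms by simp

definition well_typed :: "('c list \<Rightarrow> 'a) \<Rightarrow> bool" where
  "well_typed m \<longleftrightarrow> m \<in> (\<Pi>\<^sub>E xs \<in> lists (Ob C) - {[]}. hom V (TOb V (homs HO xs)) (HO (hd xs, last xs)))"

text \<open>Unfolds the set into plain equations between \<open>ins\<close> and
  \<open>pcomp\<close>, so that the multicategory lemmas apply directly. The next lemma does the
  same for abridged structures.\<close>

lemma extended_iff:
  "m \<in> extended_structures V C HO HA \<longleftrightarrow> well_typed m \<and>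
    (\<forall>vs \<in> lists (Ob C) - {[]}. \<forall>f \<in> Ar C.
      m (Dom C f # vs) \<odot> ins (homs HO vs) (HA (f, Id C (hd vs))) [] =
      HA (f, Id C (last vs)) \<odot> m (Cod C f # vs)) \<and>
    (\<forall>us \<in> lists (Ob C) - {[]}. \<forall>g \<in> Ar C.
      m (us @ [Cod C g]) \<odot> ins [] (HA (Id C (last us), g)) (homs HO us) =
      HA (Id C (hd us), g) \<odot> m (us @ [Dom C g])) \<and>
    (\<forall>us \<in> lists (Ob C) - {[]}. \<forall>vs \<in> lists (Ob C) - {[]}. \<forall>f \<in> Ar C.
      m (us @ [Dom C f] @ vs) \<odot> TAr V (ids V (homs HO vs) @
        [HA (f, Id C (hd vs)), HA (Id C (last us), Id C (Dom C f))] @ ids V (homs HO us)) =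
      m (us @ [Cod C f] @ vs) \<odot> TAr V (ids V (homs HO vs) @
        [HA (Id C (Cod C f), Id C (hd vs)), HA (Id C (last us), f)] @ ids V (homs HO us))) \<and>
    extranatural_to C V HA (\<lambda>x. m [x]) \<and>
    (\<forall>x \<in> Ob C. \<forall>y \<in> Ob C. m [x, y] = Counit V (HO (x, y))) \<and>
    composes m"
  unfolding extended_structures_def composes_def well_typed_def natural_def extranatural_from_def
    pcomp_def ins_def op_cat_def
  by simp

lemma abridged_iff:
  "(\<eta>, \<mu>) \<in> abridged_structures V C HO HA \<longleftrightarrow>
    \<eta> \<in> (\<Pi>\<^sub>E x \<in> Ob C. hom V (TOb V []) (HO (x, x))) \<and>
    \<mu> \<in> (\<Pi>\<^sub>E (x, y, z) \<in> Ob C \<times> Ob C \<times> Ob C. hom V (TOb V [HO (y, z), HO (x, y)]) (HO (x, z))) \<and>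
    extranatural_to C V HA \<eta> \<and>
    (\<forall>y \<in> Ob C. \<forall>z \<in> Ob C. \<forall>f \<in> Ar C.
      \<mu> (Dom C f, y, z) \<odot> ins [HO (y, z)] (HA (f, Id C y)) [] = HA (f, Id C z) \<odot> \<mu> (Cod C f, y, z)) \<and>
    (\<forall>x \<in> Ob C. \<forall>y \<in> Ob C. \<forall>g \<in> Ar C.
      \<mu> (x, y, Cod C g) \<odot> ins [] (HA (Id C y, g)) [HO (x, y)] = HA (Id C x, g) \<odot> \<mu> (x, y, Dom C g)) \<and>
    (\<forall>x \<in> Ob C. \<forall>z \<in> Ob C. \<forall>f \<in> Ar C.
      \<mu> (x, Dom C f, z) \<odot> TAr V [HA (f, Id C z), HA (Id C x, Id C (Dom C f))] =
      \<mu> (x, Cod C f, z) \<odot> TAr V [HA (Id C (Cod C f), Id C z), HA (Id C x, f)]) \<and>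
    (\<forall>w \<in> Ob C. \<forall>x \<in> Ob C. \<forall>y \<in> Ob C. \<forall>z \<in> Ob C.
      pcomp (\<mu> (w, x, z)) [] [HO (y, z), HO (x, y)] (\<mu> (x, y, z)) [HO (w, x)] =
      pcomp (\<mu> (w, y, z)) [HO (y, z)] [HO (x, y), HO (w, x)] (\<mu> (w, x, y)) []) \<and>
    (\<forall>x \<in> Ob C. \<forall>y \<in> Ob C.
      pcomp (\<mu> (x, y, y)) [] [] (\<eta> y) [HO (x, y)] = Counit V (HO (x, y)) \<and>
      pcomp (\<mu> (x, x, y)) [HO (x, y)] [] (\<eta> x) [] = Counit V (HO (x, y)))"
  unfolding abridged_structures_def natural_def extranatural_from_def
    pcomp_def ins_def op_cat_def
  by simp

lemma well_typed_hom:
  assumes "well_typed m" "xs \<in> lists (Ob C)" "xs \<noteq> []"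
  shows "m xs \<in> hom V (TOb V (homs HO xs)) (HO (hd xs, last xs))"
  using assms by (auto simp: well_typed_def)

section \<open>Restriction to an abridged structure, and its injectivity\<close>

lemma abridge_closed:
  assumes "m \<in> extended_structures V C HO HA"
  shows "abridge C m \<in> abridged_structures V C HO HA"
proof -
  have ty: "well_typed m" and cm: "composes m"
    and nat0: "\<And>f vs. f \<in> Ar C \<Longrightarrow> vs \<in> lists (Ob C) \<Longrightarrow> vs \<noteq> [] \<Longrightarrow>
      m (Dom C f # vs) \<odot> ins (homs HO vs) (HA (f, Id C (hd vs))) [] =
      HA (f, Id C (last vs)) \<odot> m (Cod C f # vs)"
    and nat1: "\<And>g us. g \<in> Ar C \<Longrightarrow> us \<in> lists (Ob C) \<Longrightarrow> us \<noteq> [] \<Longrightarrow>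
      m (us @ [Cod C g]) \<odot> ins [] (HA (Id C (last us), g)) (homs HO us) =
      HA (Id C (hd us), g) \<odot> m (us @ [Dom C g])"
    and ex: "\<And>f us vs. f \<in> Ar C \<Longrightarrow> us \<in> lists (Ob C) \<Longrightarrow> us \<noteq> [] \<Longrightarrow> vs \<in> lists (Ob C) \<Longrightarrow> vs \<noteq> [] \<Longrightarrow>
      m (us @ [Dom C f] @ vs) \<odot> TAr V (ids V (homs HO vs) @
        [HA (f, Id C (hd vs)), HA (Id C (last us), Id C (Dom C f))] @ ids V (homs HO us)) =
      m (us @ [Cod C f] @ vs) \<odot> TAr V (ids V (homs HO vs) @
        [HA (Id C (Cod C f), Id C (hd vs)), HA (Id C (last us), f)] @ ids V (homs HO us))"
    and ex_to: "extranatural_to C V HA (\<lambda>x. m [x])"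
    and counit: "\<And>x y. x \<in> Ob C \<Longrightarrow> y \<in> Ob C \<Longrightarrow> m [x, y] = Counit V (HO (x, y))"
    using assms unfolding extended_iff by blast+
  \<comment> \<open>Both sides are decompositions of \<open>m [w, x, y, z]\<close>, along the blocks
    \<open>[x, y, z]\<close> and \<open>[w, x, y]\<close>.\<close>
  have assoc: "pcomp (m [w, x, z]) [] [HO (y, z), HO (x, y)] (m [x, y, z]) [HO (w, x)] =
      pcomp (m [w, y, z]) [HO (y, z)] [HO (x, y), HO (w, x)] (m [w, x, y]) []"
    if "w \<in> Ob C" "x \<in> Ob C" "y \<in> Ob C" "z \<in> Ob C" for w x y z
    using composesD[OF cm, of "[w]" "[x, y, z]" "[]"] composesD[OF cm, of "[]" "[w, x, y]" "[z]"] that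
    by simp
  \<comment> \<open>Both composites are decompositions of \<open>m [x, y]\<close>, along the
    singleton blocks \<open>[y]\<close> and \<open>[x]\<close>.\<close>
  have unit: "pcomp (m [x, y, y]) [] [] (m [y]) [HO (x, y)] = Counit V (HO (x, y))"
    "pcomp (m [x, x, y]) [HO (x, y)] [] (m [x]) [] = Counit V (HO (x, y))"
    if "x \<in> Ob C" "y \<in> Ob C" for x y
    using composesD[OF cm, of "[x]" "[y]" "[]"] composesD[OF cm, of "[]" "[x]" "[y]"] counit that
    by simp_all
  have "extranatural_to C V HA (\<lambda>x\<in>Ob C. m [x])"
    using ex_to C.Dom_closed C.Cod_closed by (simp add: extranatural_to_def)
  moreover have "m [x] \<in> hom V (TOb V []) (HO (x, x))" if "x \<in> Ob C" for x
    using well_typed_hom[OF ty, of "[x]"] that by simp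
  moreover have "m [x, y, z] \<in> hom V (TOb V [HO (y, z), HO (x, y)]) (HO (x, z))"
    if "x \<in> Ob C" "y \<in> Ob C" "z \<in> Ob C" for x y z
    using well_typed_hom[OF ty, of "[x, y, z]"] that by simp
  moreover have "m [Dom C f, y, z] \<odot> ins [HO (y, z)] (HA (f, Id C y)) [] = HA (f, Id C z) \<odot> m [Cod C f, y, z]"
    if "f \<in> Ar C" "y \<in> Ob C" "z \<in> Ob C" for f y z
    using nat0[of f "[y, z]"] that by simp
  moreover have "m [x, y, Cod C g] \<odot> ins [] (HA (Id C y, g)) [HO (x, y)] = HA (Id C x, g) \<odot> m [x, y, Dom C g]"
    if "g \<in> Ar C" "x \<in> Ob C" "y \<in> Ob C" for g x y
    using nat1[of g "[x, y]"] that by simp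
  moreover have "m [x, Dom C f, z] \<odot> TAr V [HA (f, Id C z), HA (Id C x, Id C (Dom C f))] =
      m [x, Cod C f, z] \<odot> TAr V [HA (Id C (Cod C f), Id C z), HA (Id C x, f)]"
    if "f \<in> Ar C" "x \<in> Ob C" "z \<in> Ob C" for f x z
    using ex[of f "[x]" "[z]"] that by simp
  ultimately show ?thesis
    using assoc unit C.Dom_closed C.Cod_closed unfolding abridge_def abridged_iff
    by (simp add: PiE_iff)
qed

lemma abridge_inj: "inj_on (abridge C) (extended_structures V C HO HA)"
proof (rule inj_onI)
  fix m m'
  assume m: "m \<in> extended_structures V C HO HA" and m': "m' \<in> extended_structures V C HO HA"
    and eq: "abridge C m = abridge C m'"
  have eq1: "m [x] = m' [x]" if "x \<in> Ob C" for x
    using fun_cong[OF arg_cong[OF eq, of fst], of x] that by (simp add: abridge_def)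
  have eq3: "m [x, y, z] = m' [x, y, z]" if "x \<in> Ob C" "y \<in> Ob C" "z \<in> Ob C" for x y z
    using fun_cong[OF arg_cong[OF eq, of snd], of "(x, y, z)"] that by (simp add: abridge_def)
  have cm: "composes m" "composes m'" and ty: "well_typed m" "well_typed m'"
    using m m' unfolding extended_iff by blast+
  have "m xs = m' xs" if "xs \<in> lists (Ob C) - {[]}" for xs
    using that
  proof (induction xs)
    case (Cons x zs)
    then show ?case
      using eq1 eq3 composes_Cons[OF cm(1), of x zs] composes_Cons[OF cm(2), of x zs]
      by (cases "zs = []") auto
  qed simp
  \<comment> \<open>Outside the nonempty lists of objects both functions are
    \<open>undefined\<close>.\<close>
  with ty show "m = m'"
    unfolding well_typed_def by (rule PiE_ext)
qed

end

section \<open>Reconstruction of an extended structure from an abridged one\<close>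

locale abridged_enrichment = enrichment_functor V C HO HA
  for V :: "('o, 'a, 'y) oplax_data_scheme" (structure)
    and C :: "('c, 'f, 'z) cat_data_scheme" and HO HA +
  fixes \<eta> :: "'c \<Rightarrow> 'a" and \<mu> :: "'c \<times> 'c \<times> 'c \<Rightarrow> 'a"
  assumes abridged: "(\<eta>, \<mu>) \<in> abridged_structures V C HO HA"
begin

lemma eta_hom: "x \<in> Ob C \<Longrightarrow> \<eta> x \<in> hom V (TOb V []) (HO (x, x))"
  using abridged unfolding abridged_iff by blast

lemma mu_hom:
  assumes "x \<in> Ob C" "y \<in> Ob C" "z \<in> Ob C"
  shows "\<mu> (x, y, z) \<in> hom V (TOb V [HO (y, z), HO (x, y)]) (HO (x, z))"
proof -
  have "\<mu> \<in> (\<Pi>\<^sub>E (x, y, z) \<in> Ob C \<times> Ob C \<times> Ob C. hom V (TOb V [HO (y, z), HO (x, y)]) (HO (x, z)))"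
    using abridged unfolding abridged_iff by blast
  from PiE_mem[OF this, of "(x, y, z)"] show ?thesis
    using assms by simp
qed

lemma mu_assoc:
  assumes "w \<in> Ob C" "x \<in> Ob C" "y \<in> Ob C" "z \<in> Ob C"
  shows "pcomp (\<mu> (w, x, z)) [] [HO (y, z), HO (x, y)] (\<mu> (x, y, z)) [HO (w, x)] =
    pcomp (\<mu> (w, y, z)) [HO (y, z)] [HO (x, y), HO (w, x)] (\<mu> (w, x, y)) []"
  using abridged assms unfolding abridged_iff by blast

lemma mu_eta:
  assumes "x \<in> Ob C" "y \<in> Ob C"
  shows "pcomp (\<mu> (x, y, y)) [] [] (\<eta> y) [HO (x, y)] = Counit V (HO (x, y))"
    "pcomp (\<mu> (x, x, y)) [HO (x, y)] [] (\<eta> x) [] = Counit V (HO (x, y))"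
  using abridged assms unfolding abridged_iff by blast+

text \<open>The recursion forced by \<open>composes_Cons\<close>. The tail fills the left slot of
  \<open>\<mu>\<close> because \<open>homs\<close> reverses the order. A pair is not a separate
  case: it yields \<open>\<mu>\<close> with \<open>\<eta>\<close> plugged in, which unitality
  identifies with the counit.\<close>

fun ext :: "'c list \<Rightarrow> 'a" where
  "ext [] = undefined"
| "ext [x] = \<eta> x"
| "ext (x # y # zs) =
    pcomp (\<mu> (x, y, last (y # zs))) [] (homs HO (y # zs)) (ext (y # zs)) [HO (x, y)]"

lemma ext_Cons:
  "zs \<noteq> [] \<Longrightarrow>
    ext (x # zs) = pcomp (\<mu> (x, hd zs, last zs)) [] (homs HO zs) (ext zs) [HO (x, hd zs)]"
  by (cases zs) auto

lemma ext_hom: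
  "xs \<in> lists (Ob C) \<Longrightarrow> xs \<noteq> [] \<Longrightarrow>
    ext xs \<in> hom V (TOb V (homs HO xs)) (HO (hd xs, last xs))"
proof (induction xs)
  case (Cons x zs)
  show ?case
  proof (cases "zs = []")
    case True
    then show ?thesis
      using eta_hom Cons.prems by simp
  next
    case False
    then show ?thesis
      using pcomp_hom[of "[]" "[HO (x, hd zs)]" "homs HO zs" "ext zs" "HO (hd zs, last zs)"
          "\<mu> (x, hd zs, last zs)" "HO (x, last zs)"] Cons mu_hom[of x "hd zs" "last zs"]
      by (simp add: ext_Cons homs_Cons)
  qed
qed simp

lemma ext_pair: "x \<in> Ob C \<Longrightarrow> y \<in> Ob C \<Longrightarrow> ext [x, y] = Counit V (HO (x, y))"
  by (simp add: mu_eta)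

text \<open>The recursion plugs \<open>ext [y, z]\<close> into \<open>\<mu>\<close>; this is a
  counit, hence an identity for partial composition.\<close>

lemma ext_triple:
  assumes "x \<in> Ob C" "y \<in> Ob C" "z \<in> Ob C"
  shows "ext [x, y, z] = \<mu> (x, y, z)"
  using pcomp_Counit_right[of "[]" "[HO (x, y)]" "HO (y, z)" "\<mu> (x, y, z)" "HO (x, z)"]
    mu_hom[OF assms] assms by (simp add: mu_eta)

text \<open>The composition law for a block at the start of the list, where the recursion acts
  inside the block. All uses of associativity and of the second unit law are concentrated
  here.\<close>

lemma ext_pcomp_initial:
  assumes "vs \<in> lists (Ob C)"
  shows "ys \<in> lists (Ob C) \<Longrightarrow> ys \<noteq> [] \<Longrightarrow> ext (ys @ vs) =
    pcomp (ext (hd ys # last ys # vs)) (homs HO (last ys # vs)) (homs HO ys) (ext ys) []"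
proof (induction ys)
  case (Cons y ys)
  define b where "b = last (y # ys)"
  define l where "l = last (b # vs)"
  define P where "P = homs HO (b # vs)"
  have y [simp]: "y \<in> Ob C" and ys: "ys \<in> lists (Ob C)"
    using Cons.prems by auto
  have b [simp]: "b \<in> Ob C"
    using hd_last_closed[OF Cons.prems] by (simp add: b_def)
  have l [simp]: "l \<in> Ob C"
    using assms b unfolding l_def by (intro hd_last_closed) auto
  have P [simp]: "P \<in> lists (Ob V)"
    using assms by (simp add: P_def)
  have e_vs: "ext (b # vs) \<in> hom V (TOb V P) (HO (b, l))"
    using ext_hom[of "b # vs"] assms by (simp add: P_def l_def)
  \<comment> \<open>This also covers empty \<open>vs\<close>, with \<open>P = []\<close>,
    \<open>l = b\<close> and \<open>ext (b # vs) = \<eta> b\<close>.\<close>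
  have ext_b: "ext (x # b # vs) = pcomp (\<mu> (x, b, l)) [] P (ext (b # vs)) [HO (x, b)]" for x
    by (simp add: P_def l_def)
  show ?case
  proof (cases "ys = []")
    case True
    then have "b = y"
      by (simp add: b_def)
    \<comment> \<open>The tail and \<open>\<eta> y\<close> fill different slots of
      \<open>\<mu> (y, y, l)\<close>, so \<open>\<eta> y\<close> may be plugged in first, where the
      second unit law applies.\<close>
    have "pcomp (ext (y # b # vs)) P [] (\<eta> y) []
        = pcomp (pcomp (\<mu> (y, y, l)) [HO (y, l)] [] (\<eta> y) []) [] P (ext (b # vs)) []"
      using pcomp_parallel[of "[]" P "[]" "[]" "[]" "ext (b # vs)" "HO (y, l)" "\<eta> y" "HO (y, y)"
          "\<mu> (y, y, l)" "HO (y, l)"] e_vs eta_hom[OF y] mu_hom[of y y l]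
      unfolding ext_b unfolding \<open>b = y\<close> by (simp del: ext.simps)
    also have "\<dots> = ext (b # vs)"
      using pcomp_Counit_left[OF P] e_vs by (simp add: mu_eta \<open>b = y\<close>)
    finally show ?thesis
      by (simp add: True P_def \<open>b = y\<close>)
  next
    case False
    define y' where "y' = hd ys"
    define Y where "Y = homs HO ys"
    define K where "K = HO (y, y')"
    have y' [simp]: "y' \<in> Ob C"
      using ys False by (simp add: y'_def)
    have Y [simp]: "Y \<in> lists (Ob V)" and K [simp]: "K \<in> Ob V"
      using ys by (simp_all add: Y_def K_def)
    have last_ys: "last ys = b"
      using False by (simp add: b_def)
    have e_ys: "ext ys \<in> hom V (TOb V Y) (HO (y', b))"
      using ext_hom[OF ys False] by (simp add: y'_def Y_def last_ys)
    have e_y'b: "ext (y' # b # vs) \<in> hom V (TOb V (P @ [HO (y', b)])) (HO (y', l))"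
      using ext_hom[of "y' # b # vs"] assms by (simp add: P_def l_def)
    have e_yb: "ext (y # b # vs) \<in> hom V (TOb V (P @ [HO (y, b)])) (HO (y, l))"
      using ext_hom[of "y # b # vs"] assms by (simp add: P_def l_def)
    have l_eq: "last (ys @ vs) = l"
      using False by (simp add: l_def last_ys[symmetric])
    have homs_eq: "homs HO (ys @ vs) = P @ Y"
      using homs_split[OF False, of HO "[]" vs] by (simp add: P_def Y_def last_ys)
    have IH: "ext (ys @ vs) = pcomp (ext (y' # b # vs)) P Y (ext ys) []"
      using Cons.IH[OF ys False] by (simp add: y'_def last_ys P_def Y_def)
    \<comment> \<open>This is the claim for the block \<open>[y, y', b]\<close>: expose the second
      \<open>\<mu>\<close>, rebracket by \<open>mu_assoc\<close>, then plug the tail back in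
      parallel.\<close>
    have step: "pcomp (\<mu> (y, y', l)) [] (P @ [HO (y', b)]) (ext (y' # b # vs)) [K]
        = pcomp (ext (y # b # vs)) P [HO (y', b), K] (\<mu> (y, y', b)) []"
    proof -
      have "pcomp (\<mu> (y, y', l)) [] (P @ [HO (y', b)]) (ext (y' # b # vs)) [K]
        = pcomp (pcomp (\<mu> (y, y', l)) [] [HO (b, l), HO (y', b)] (\<mu> (y', b, l)) [K])
            [] P (ext (b # vs)) [HO (y', b), K]"
        unfolding ext_b
        using pcomp_nested[of "[]" "[]" P "[HO (y', b)]" "[K]" "ext (b # vs)" "HO (b, l)"
            "\<mu> (y', b, l)" "HO (y', l)" "\<mu> (y, y', l)" "HO (y, l)"] e_vs
          mu_hom[of y y' l] mu_hom[of y' b l]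
        by (simp add: K_def)
      also have "\<dots> = pcomp (pcomp (\<mu> (y, b, l)) [HO (b, l)] [HO (y', b), K] (\<mu> (y, y', b)) [])
            [] P (ext (b # vs)) [HO (y', b), K]"
        using mu_assoc[of y y' b l] by (simp add: K_def)
      also have "\<dots> = pcomp (ext (y # b # vs)) P [HO (y', b), K] (\<mu> (y, y', b)) []"
        unfolding ext_b
        using pcomp_parallel[of "[]" P "[]" "[HO (y', b), K]" "[]" "ext (b # vs)" "HO (b, l)"
            "\<mu> (y, y', b)" "HO (y, b)" "\<mu> (y, b, l)" "HO (y, l)"] e_vs
          mu_hom[of y y' b] mu_hom[of y b l]
        by (simp add: K_def)
      finally show ?thesis .
    qed
    \<comment> \<open>With the induction hypothesis inserted, \<open>ext ys\<close> is pulled to the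
      outside, \<open>step\<close> is applied beneath it, and \<open>ext ys\<close> is pushed into
      \<open>\<mu> (y, y', b)\<close>, which rebuilds \<open>ext (y # ys)\<close>.\<close>
    have "ext ((y # ys) @ vs)
        = pcomp (\<mu> (y, y', l)) [] (P @ Y) (pcomp (ext (y' # b # vs)) P Y (ext ys) []) [K]"
      using False by (simp add: ext_Cons IH homs_eq l_eq y'_def[symmetric] K_def)
    also have "\<dots> = pcomp (pcomp (\<mu> (y, y', l)) [] (P @ [HO (y', b)]) (ext (y' # b # vs)) [K])
        P Y (ext ys) [K]"
      using pcomp_nested[of "[]" P Y "[]" "[K]" "ext ys" "HO (y', b)" "ext (y' # b # vs)"
          "HO (y', l)" "\<mu> (y, y', l)" "HO (y, l)"] e_ys e_y'b mu_hom[of y y' l]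
      by (simp add: K_def)
    also have "\<dots> = pcomp (ext (y # b # vs)) P (Y @ [K])
        (pcomp (\<mu> (y, y', b)) [] Y (ext ys) [K]) []"
      unfolding step
      using pcomp_nested[of P "[]" Y "[K]" "[]" "ext ys" "HO (y', b)" "\<mu> (y, y', b)"
          "HO (y, b)" "ext (y # b # vs)" "HO (y, l)"] e_ys e_yb mu_hom[of y y' b]
      by (simp add: K_def)
    also have "pcomp (\<mu> (y, y', b)) [] Y (ext ys) [K] = ext (y # ys)"
      using False by (simp add: ext_Cons last_ys y'_def Y_def K_def)
    also have "Y @ [K] = homs HO (y # ys)"
      using False by (simp add: homs_Cons y'_def Y_def K_def)
    finally show ?thesis
      by (simp only: P_def b_def list.sel(1))
  qed
qed simp

text \<open>Objects before the block only add an outermost \<open>\<mu>\<close> each, so induction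
  on \<open>us\<close> needs sequential associativity alone.\<close>

lemma ext_pcomp:
  assumes ys: "ys \<in> lists (Ob C)" "ys \<noteq> []" and vs: "vs \<in> lists (Ob C)"
  shows "us \<in> lists (Ob C) \<Longrightarrow> ext (us @ ys @ vs) =
    pcomp (ext (us @ hd ys # last ys # vs)) (homs HO (last ys # vs)) (homs HO ys) (ext ys)
      (homs HO (us @ [hd ys]))"
proof (induction us)
  case Nil
  then show ?case
    using ext_pcomp_initial[OF vs ys] by (simp del: ext.simps)
next
  case (Cons u us)
  let ?a = "hd ys" and ?b = "last ys"
  define h where "h = hd (us @ ys @ vs)"
  define l where "l = last (us @ ys @ vs)"
  \<comment> \<open>Replacing the block by its two endpoints preserves the first and last object of
    the list, so the outermost \<open>\<mu>\<close> is the same on both sides.\<close>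
  have h: "hd (us @ ?a # ?b # vs) = h" "hd (us @ [?a]) = h"
    and l: "last (us @ ?a # ?b # vs) = l"
    using ys(2) by (auto simp: h_def l_def hd_append)
  have mem: "u \<in> Ob C" "us \<in> lists (Ob C)" "?a \<in> Ob C" "?b \<in> Ob C" "h \<in> Ob C" "l \<in> Ob C"
    using Cons.prems ys vs hd_last_closed[OF ys] hd_last_closed[of "us @ ys @ vs"]
    by (auto simp: h_def l_def)
  have "ext ((u # us) @ ys @ vs) = pcomp (\<mu> (u, h, l)) []
      (homs HO (?b # vs) @ homs HO ys @ homs HO (us @ [?a])) (ext (us @ ys @ vs)) [HO (u, h)]"
    using ys(2) ext_Cons[of "us @ ys @ vs" u] homs_split[OF ys(2), of HO us vs]
    by (simp add: h_def l_def del: ext.simps)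
  also have "\<dots> = pcomp (pcomp (\<mu> (u, h, l)) [] (homs HO (us @ ?a # ?b # vs))
      (ext (us @ ?a # ?b # vs)) [HO (u, h)])
      (homs HO (?b # vs)) (homs HO ys) (ext ys) (homs HO (us @ [?a]) @ [HO (u, h)])"
    using pcomp_nested[of "[]" "homs HO (?b # vs)" "homs HO ys" "homs HO (us @ [?a])" "[HO (u, h)]"
        "ext ys" "HO (?a, ?b)" "ext (us @ ?a # ?b # vs)" "HO (h, l)" "\<mu> (u, h, l)" "HO (u, l)"]
      ext_hom[OF ys] ext_hom[of "us @ ?a # ?b # vs"] mu_hom[of u h l] mem ys vs Cons.IH
      homs_split[of "[?a, ?b]" HO us vs] h l
    by (simp del: ext.simps)
  also have "pcomp (\<mu> (u, h, l)) [] (homs HO (us @ ?a # ?b # vs)) (ext (us @ ?a # ?b # vs)) [HO (u, h)]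
      = ext ((u # us) @ ?a # ?b # vs)"
    using ext_Cons[of "us @ ?a # ?b # vs" u] h l by (simp del: ext.simps)
  also have "homs HO (us @ [?a]) @ [HO (u, h)] = homs HO ((u # us) @ [?a])"
    using homs_Cons[of "us @ [?a]" HO u] h by simp
  finally show ?case .
qed

section \<open>Naturality in the outer variables and extranaturality in the inner ones\<close>

lemma ext_natural_first:
  assumes "f \<in> Ar C" "vs \<in> lists (Ob C)" "vs \<noteq> []"
  shows "ext (Dom C f # vs) \<odot> ins (homs HO vs) (HA (f, Id C (hd vs))) [] =
    HA (f, Id C (last vs)) \<odot> ext (Cod C f # vs)"
proof -
  let ?h = "hd vs" and ?l = "last vs"
  have mem: "Dom C f \<in> Ob C" "Cod C f \<in> Ob C" "?h \<in> Ob C" "?l \<in> Ob C"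
    using assms C.Dom_closed C.Cod_closed by auto
  have nat: "\<mu> (Dom C f, ?h, ?l) \<odot> ins [HO (?h, ?l)] (HA (f, Id C ?h)) []
      = HA (f, Id C ?l) \<odot> \<mu> (Cod C f, ?h, ?l)"
    using abridged mem(3,4) assms(1) unfolding abridged_iff by blast
  have h: "HA (f, Id C ?h) \<in> hom V (HO (Cod C f, ?h)) (HO (Dom C f, ?h))"
    "HA (f, Id C ?l) \<in> hom V (HO (Cod C f, ?l)) (HO (Dom C f, ?l))"
    using HA_hom[OF assms(1), of "Id C ?h"] HA_hom[OF assms(1), of "Id C ?l"] mem by simp_all
  \<comment> \<open>The first variable occurs only in the outermost \<open>\<mu>\<close> of the
    recursion and not in the plugged tail, so the arrow moves into that
    \<open>\<mu>\<close>.\<close>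
  have "ext (Dom C f # vs) \<odot> ins (homs HO vs) (HA (f, Id C ?h)) []
      = pcomp (\<mu> (Dom C f, ?h, ?l) \<odot> ins [HO (?h, ?l)] (HA (f, Id C ?h)) [])
          [] (homs HO vs) (ext vs) [HO (Cod C f, ?h)]"
    using pcomp_ins_right[of "[]" "homs HO vs" "HA (f, Id C ?h)" "HO (Cod C f, ?h)" "HO (Dom C f, ?h)"
        "[]" "[]" "ext vs" "HO (?h, ?l)" "\<mu> (Dom C f, ?h, ?l)" "HO (Dom C f, ?l)"]
      ext_hom[OF assms(2,3)] mu_hom[of "Dom C f" ?h ?l] h mem assms
    by (simp add: ext_Cons)
  also have "\<dots> = HA (f, Id C ?l) \<odot> ext (Cod C f # vs)"
    unfolding nat ext_Cons[OF assms(3)]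
    using mem assms ext_hom[OF assms(2,3)] mu_hom[of "Cod C f" ?h ?l] h
    by (intro Comp_pcomp[symmetric]) auto
  finally show ?thesis .
qed

lemma ext_natural_last:
  assumes "g \<in> Ar C" "us \<in> lists (Ob C)" "us \<noteq> []"
  shows "ext (us @ [Cod C g]) \<odot> ins [] (HA (Id C (last us), g)) (homs HO us) =
    HA (Id C (hd us), g) \<odot> ext (us @ [Dom C g])"
proof -
  let ?h = "hd us" and ?l = "last us"
  have mem: "Dom C g \<in> Ob C" "Cod C g \<in> Ob C" "?h \<in> Ob C" "?l \<in> Ob C"
    using assms C.Dom_closed C.Cod_closed by auto
  have nat: "\<mu> (?h, ?l, Cod C g) \<odot> ins [] (HA (Id C ?l, g)) [HO (?h, ?l)]
      = HA (Id C ?h, g) \<odot> \<mu> (?h, ?l, Dom C g)"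
    using abridged mem(3,4) assms(1) unfolding abridged_iff by blast
  have h: "HA (Id C ?l, g) \<in> hom V (HO (?l, Dom C g)) (HO (?l, Cod C g))"
    "HA (Id C ?h, g) \<in> hom V (HO (?h, Dom C g)) (HO (?h, Cod C g))"
    using HA_hom[OF _ assms(1), of "Id C ?h"] HA_hom[OF _ assms(1), of "Id C ?l"] mem by simp_all
  \<comment> \<open>The recursion buries the last variable in the tail. The composition law with
    \<open>us\<close> as initial block gives another decomposition, whose outer \<open>\<mu>\<close>
    contains it.\<close>
  have ext: "ext (us @ [x]) = pcomp (\<mu> (?h, ?l, x)) [HO (?l, x)] (homs HO us) (ext us) []"
    if "x \<in> Ob C" for x
    using ext_pcomp_initial[OF _ assms(2,3), of "[x]"] ext_triple[of ?h ?l x] that mem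
    by (simp del: ext.simps)
  have "ext (us @ [Cod C g]) \<odot> ins [] (HA (Id C ?l, g)) (homs HO us)
      = pcomp (\<mu> (?h, ?l, Cod C g) \<odot> ins [] (HA (Id C ?l, g)) [HO (?h, ?l)])
          [HO (?l, Dom C g)] (homs HO us) (ext us) []"
    using pcomp_ins_left[of "[]" "homs HO us" "HA (Id C ?l, g)" "HO (?l, Dom C g)" "HO (?l, Cod C g)"
        "[]" "[]" "ext us" "HO (?h, ?l)" "\<mu> (?h, ?l, Cod C g)" "HO (?h, Cod C g)"]
      ext_hom[OF assms(2,3)] mu_hom[of ?h ?l "Cod C g"] h mem assms
    by (simp add: ext)
  also have "\<dots> = HA (Id C ?h, g) \<odot> ext (us @ [Dom C g])"
    unfolding nat ext[OF mem(1)]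
    using mem assms ext_hom[OF assms(2,3)] mu_hom[of ?h ?l "Dom C g"] h
    by (intro Comp_pcomp[symmetric]) auto
  finally show ?thesis .
qed

text \<open>Decomposing along the block \<open>[last us, x, hd vs]\<close> confines \<open>x\<close>
  to a single inner \<open>\<mu>\<close>; the two arrows sit exactly on the inputs of that
  \<open>\<mu>\<close>.\<close>

lemma ext_TAr_middle:
  assumes us: "us \<in> lists (Ob C)" "us \<noteq> []" and vs: "vs \<in> lists (Ob C)" "vs \<noteq> []"
    and x: "x \<in> Ob C"
    and p: "p \<in> hom V a (HO (x, hd vs))" and q: "q \<in> hom V b (HO (last us, x))"
  shows "ext (us @ [x] @ vs) \<odot> TAr V (ids V (homs HO vs) @ [p, q] @ ids V (homs HO us)) =
    pcomp (ext (us @ vs)) (homs HO vs) [a, b] (\<mu> (last us, x, hd vs) \<odot> TAr V [p, q]) (homs HO us)"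
proof -
  obtain us' l where us_eq: "us = us' @ [l]"
    using us(2) by (cases us rule: rev_cases) auto
  obtain h vs' where vs_eq: "vs = h # vs'"
    using vs(2) by (cases vs) auto
  have mem: "us' \<in> lists (Ob C)" "l \<in> Ob C" "h \<in> Ob C" "vs' \<in> lists (Ob C)"
    using us(1) vs(1) by (auto simp: us_eq vs_eq)
  have ext: "ext (us @ [x] @ vs) = pcomp (ext (us @ vs)) (homs HO vs)
      [HO (x, h), HO (l, x)] (\<mu> (l, x, h)) (homs HO us)"
    using ext_pcomp[of "[l, x, h]" vs' us'] ext_triple[of l x h] mem x
    by (simp add: us_eq vs_eq del: ext.simps)
  have homs_eq: "homs HO (us @ vs) = homs HO vs @ [HO (l, h)] @ homs HO us"
    using homs_split[of "[l, h]" HO us' vs'] by (simp add: us_eq vs_eq)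
  have "ext (us @ vs) \<in> hom V (TOb V (homs HO vs @ [HO (l, h)] @ homs HO us)) (HO (hd us, last vs))"
    using ext_hom[of "us @ vs"] homs_eq us vs by simp
  then show ?thesis
    using pcomp_TAr_inner[of "homs HO vs" "homs HO us" "[p, q]" "\<mu> (l, x, h)" "HO (l, h)"
        "ext (us @ vs)" "HO (hd us, last vs)"] mu_hom[of l x h] mem x us vs
      hom_ArD[OF p] hom_ArD[OF q]
    unfolding ext by (simp add: us_eq vs_eq del: ext.simps)
qed

lemma ext_extranatural:
  assumes f: "f \<in> Ar C" and us: "us \<in> lists (Ob C)" "us \<noteq> []" and vs: "vs \<in> lists (Ob C)" "vs \<noteq> []"
  shows "ext (us @ [Dom C f] @ vs) \<odot> TAr V (ids V (homs HO vs) @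
      [HA (f, Id C (hd vs)), HA (Id C (last us), Id C (Dom C f))] @ ids V (homs HO us)) =
    ext (us @ [Cod C f] @ vs) \<odot> TAr V (ids V (homs HO vs) @
      [HA (Id C (Cod C f), Id C (hd vs)), HA (Id C (last us), f)] @ ids V (homs HO us))"
proof -
  let ?l = "last us" and ?h = "hd vs"
  have mem: "?l \<in> Ob C" "?h \<in> Ob C" "Dom C f \<in> Ob C" "Cod C f \<in> Ob C"
    using us vs f C.Dom_closed C.Cod_closed by auto
  have "\<mu> (?l, Dom C f, ?h) \<odot> TAr V [HA (f, Id C ?h), HA (Id C ?l, Id C (Dom C f))] =
      \<mu> (?l, Cod C f, ?h) \<odot> TAr V [HA (Id C (Cod C f), Id C ?h), HA (Id C ?l, f)]"
    using abridged f mem(1,2) unfolding abridged_iff by blast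
  moreover have "HA (f, Id C ?h) \<in> hom V (HO (Cod C f, ?h)) (HO (Dom C f, ?h))"
    "HA (Id C ?l, Id C (Dom C f)) \<in> hom V (HO (?l, Dom C f)) (HO (?l, Dom C f))"
    "HA (Id C (Cod C f), Id C ?h) \<in> hom V (HO (Cod C f, ?h)) (HO (Cod C f, ?h))"
    "HA (Id C ?l, f) \<in> hom V (HO (?l, Dom C f)) (HO (?l, Cod C f))"
    using HA_hom[OF f, of "Id C ?h"] HA_hom[of "Id C ?l" "Id C (Dom C f)"]
      HA_hom[of "Id C (Cod C f)" "Id C ?h"] HA_hom[OF _ f, of "Id C ?l"] mem by simp_all
  \<comment> \<open>In both instances of \<open>ext_TAr_middle\<close> the arrows have the same
    sources and the outer factor is \<open>ext (us @ vs)\<close>, so only the two sides of the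
    extranaturality of \<open>\<mu>\<close> differ.\<close>
  ultimately show ?thesis
    by (simp only: ext_TAr_middle[OF us vs mem(3)] ext_TAr_middle[OF us vs mem(4)])
qed

section \<open>Surjectivity and the bijection\<close>

lemma ext_extended: "(\<lambda>xs \<in> lists (Ob C) - {[]}. ext xs) \<in> extended_structures V C HO HA"
proof -
  let ?m = "\<lambda>xs \<in> lists (Ob C) - {[]}. ext xs"
  have "well_typed ?m"
    by (simp add: well_typed_def ext_hom)
  moreover have "composes ?m"
    by (auto simp: composes_def ext_pcomp simp del: ext.simps)
  moreover have "extranatural_to C V HA (\<lambda>x. ?m [x])"
    using abridged C.Dom_closed C.Cod_closed unfolding abridged_iff
    by (simp add: extranatural_to_def)
  ultimately show ?thesis
    using ext_natural_first ext_natural_last ext_extranatural ext_pair C.Dom_closed C.Cod_closed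
    unfolding extended_iff by (simp del: ext.simps(3))
qed

text \<open>On objects \<open>\<eta>\<close> returns by definition of \<open>ext\<close> and
  \<open>\<mu>\<close> by \<open>ext_triple\<close>; elsewhere both sides are
  \<open>undefined\<close>.\<close>

lemma abridge_ext: "abridge C (\<lambda>xs \<in> lists (Ob C) - {[]}. ext xs) = (\<eta>, \<mu>)"
proof -
  have "\<eta> \<in> extensional (Ob C)" "\<mu> \<in> extensional (Ob C \<times> Ob C \<times> Ob C)"
    using abridged by (auto simp: abridged_iff PiE_def)
  then show ?thesis
    by (auto simp: abridge_def ext_triple simp del: ext.simps(3)
        intro!: extensionalityI[where A = "Ob C"] extensionalityI[where A = "Ob C \<times> Ob C \<times> Ob C"])
qed

end

theorem mainTheorem1:
  fixes V :: "('o, 'a) oplax_data"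
    and C :: "('c, 'f) cat_data"
    and HO :: "'c \<times> 'c \<Rightarrow> 'o"
    and HA :: "'f \<times> 'f \<Rightarrow> 'a"
  assumes "oplax_monoidal_category V"
    and "category C"
    and "is_functor (prod_cat (op_cat C) C) V HO HA"
  shows "bij_betw (abridge C) (extended_structures V C HO HA) (abridged_structures V C HO HA)"
proof -
  interpret enrichment_functor V C HO HA
    using assms by (simp add: enrichment_functor_def enrichment_functor_axioms_def)
  have "p \<in> abridge C ` extended_structures V C HO HA" if "p \<in> abridged_structures V C HO HA" for p
  proof -
    obtain \<eta> \<mu> where p: "p = (\<eta>, \<mu>)"
      by (cases p)
    interpret abridged_enrichment V C HO HA \<eta> \<mu>
      using that by unfold_locales (simp add: p)
    show ?thesis
      using ext_extended abridge_ext unfolding p by (metis image_eqI)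
  qed
  then show ?thesis
    using abridge_closed abridge_inj by (auto simp: bij_betw_def)
qed

end
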